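(* Let $f(s)=\sum_{k\ge0}p_ks^k$ be a $(q,r)$-extendable probability generating function with $f'(r)<\infty$, let $\gamma=\dfrac{1-f'(q)}{f'(r)-1}$, and let $$\psi_{q,r}(x)=\frac{f^{(4)}(q,q,r,x)-\gamma f^{(4)}(q,r,r,x)}{f^{(3)}(q,r,x)},\qquad x\in[0,r).$$ Then $\int_0^r|\psi_{q,r}(x)|\,dx<\infty$ if and only if $$\sum_{k=2}^\infty p_kr^kk\ln k<\infty.$$ If the latter condition does not hold, then the function $\mathcal L_{q,r}(x)=\exp\big\{\int_0^{r-x}\psi_{q,r}(s)\,ds\big\}$ is slowly varying as $x\to0$ and $\mathcal L_{q,r}(x)\to0$ as $x\to0$.
   Context: A possibly defective probability generating function is a power series $f(s)=\sum_{k\ge0}p_ks^k$ with $p_k\ge0$ and $f(1)\le1$; it is assumed that $p_1\neq1$. It is $(q,r)$-extendable, where $0\le q\le1\le r<\infty$, $q<r$, if $f(q)=q$ and $f(r)=r$. Tail generating functions: for $v(s)=\sum_{k\ge0}v_ks^k$ with all $v_k\ge0$ and $n\ge1$, $$v^{(n)}(s_1,\ldots,s_n)=\sum_{i_1\ge0,\ldots,i_n\ge0}v_{i_1+\cdots+i_n+n-1}\,s_1^{i_1}\cdots s_n^{i_n}.$$ A positive function $\mathcal L$ is slowly varying as $x\to0$ if $\mathcal L(cx)/\mathcal L(x)\to1$ as $x\downarrow0$ for every $c>0$. *)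

theory Defs
  imports "HOL-Analysis.Analysis"
begin

text \<open>A power series $f(s) = \sum_k p_k s^k$ is represented by its coefficient sequence
  \<open>p :: nat \<Rightarrow> real\<close>.\<close>

definition defective_pgf :: "(nat \<Rightarrow> real) \<Rightarrow> bool" where
  "defective_pgf p \<longleftrightarrow>
     (\<forall>k. 0 \<le> p k) \<and> summable p \<and> (\<Sum>k. p k) \<le> 1 \<and> p 1 \<noteq> 1"

text \<open>Using \<open>sums\<close> makes convergence of the series at \<open>q\<close> and \<open>r\<close> part of
  $f(q) = q$ and $f(r) = r$.\<close>

definition extendable :: "real \<Rightarrow> real \<Rightarrow> (nat \<Rightarrow> real) \<Rightarrow> bool" where
  "extendable q r p \<longleftrightarrow>
     0 \<le> q \<and> q \<le> 1 \<and> 1 \<le> r \<and> q < r \<and>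
     (\<lambda>k. p k * q ^ k) sums q \<and> (\<lambda>k. p k * r ^ k) sums r"

text \<open>The derivative $f'(s) = \sum_{k \ge 1} k p_k s^{k-1}$ is taken termwise, since \<open>r\<close> may be the
  radius of convergence of \<open>f\<close>, where \<open>f\<close> has at most a left derivative. Inside the disc of
  convergence this is the usual derivative (\<open>termdiffs\<close>). At \<open>r\<close>, the condition
  $f'(r) < \infty$ is \<open>pgf_deriv_finite p r\<close>.\<close>

definition pgf_deriv :: "(nat \<Rightarrow> real) \<Rightarrow> real \<Rightarrow> real" where
  "pgf_deriv p s = (\<Sum>k. diffs p k * s ^ k)"

definition pgf_deriv_finite :: "(nat \<Rightarrow> real) \<Rightarrow> real \<Rightarrow> bool" where
  "pgf_deriv_finite p s \<longleftrightarrow> summable (\<lambda>k. diffs p k * s ^ k)"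

text \<open>\<open>tail_gf v [s\<^sub>1, \<dots>, s\<^sub>n]\<close> is $v^{(n)}(s_1, \dots, s_n)$, for $n \ge 1$; the sum ranges over
  all multi-indices $(i_1, \dots, i_n)$, given as lists of length \<open>n\<close>.\<close>

definition tail_gf :: "(nat \<Rightarrow> real) \<Rightarrow> real list \<Rightarrow> real" where
  "tail_gf v ss =
     (\<Sum>\<^sub>\<infinity>i\<in>{i. length i = length ss}.
        v (sum_list i + length ss - 1) * (\<Prod>j<length ss. (ss ! j) ^ (i ! j)))"

definition gamma_qr :: "(nat \<Rightarrow> real) \<Rightarrow> real \<Rightarrow> real \<Rightarrow> real" where
  "gamma_qr p q r = (1 - pgf_deriv p q) / (pgf_deriv p r - 1)"

definition psi_qr :: "(nat \<Rightarrow> real) \<Rightarrow> real \<Rightarrow> real \<Rightarrow> real \<Rightarrow> real" where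
  "psi_qr p q r x =
     (tail_gf p [q, q, r, x] - gamma_qr p q r * tail_gf p [q, r, r, x]) / tail_gf p [q, r, x]"

definition L_qr :: "(nat \<Rightarrow> real) \<Rightarrow> real \<Rightarrow> real \<Rightarrow> real \<Rightarrow> real" where
  "L_qr p q r x = exp (LBINT s:{0..r - x}. psi_qr p q r s)"

text \<open>Positivity is only required near \<open>0\<close>, so that the notion does not depend on how a function
  with domain $(0, r)$ is extended.\<close>

definition slowly_varying_at_0 :: "(real \<Rightarrow> real) \<Rightarrow> bool" where
  "slowly_varying_at_0 L \<longleftrightarrow>
     (\<forall>\<^sub>F x in at_right 0. 0 < L x) \<and>
     (\<forall>c>0. ((\<lambda>x. L (c * x) / L x) \<longlongrightarrow> 1) (at_right 0))"

end

theory Submission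
  imports Defs
begin

text \<open>
  Replacing \<open>v\<close> by the coefficients \<open>tail_coeff s v\<close> of the divided difference
  $x \mapsto (v(x) - v(s))/(x - s)$ removes the argument \<open>s\<close> from a tail generating function.
  With $g(x) = f^{(3)}(q,r,x)$, $w(x) = f^{(4)}(q,r,r,x) = (g(r) - g(x))/(r - x)$ and
  $e(x) = f^{(4)}(q,q,r,x)$ this gives $\psi = (e - \gamma w)/g$. On $[0,r]$ the functions \<open>g\<close> and
  \<open>e\<close> are continuous and bounded and \<open>g\<close> is bounded away from 0, and $\gamma > 0$, so
  $\psi$ is integrable iff \<open>w\<close> is. Termwise integration expresses $\int_0^r w$
  as a sum of the $p_k r^k$ with weights comparable to $k \ln k$ (two nested harmonic sums). Finally
  $(r - x)\psi(x) \to 0$ because \<open>g\<close> is continuous at \<open>r\<close>, and this yields slow variation; the limit 0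
  comes from $\int w = \infty$.
\<close>

section \<open>Coefficients of divided differences and exchange of summation\<close>

definition tail_coeff :: "real \<Rightarrow> (nat \<Rightarrow> real) \<Rightarrow> nat \<Rightarrow> real" where
  "tail_coeff s v j = (\<Sum>i. v (j + i + 1) * s ^ i)"

lemma tail_coeff_nonneg:
  assumes "\<And>k. 0 \<le> v k" "0 \<le> s" "summable (\<lambda>i. v (j + i + 1) * s ^ i)"
  shows "0 \<le> tail_coeff s v j"
  unfolding tail_coeff_def using assms by (intro suminf_nonneg) auto

lemma suminf_ennreal_swap:
  fixes f :: "nat \<Rightarrow> nat \<Rightarrow> ennreal"
  shows "(\<Sum>i. \<Sum>j. f i j) = (\<Sum>j. \<Sum>i. f i j)"
  using nn_integral_suminf[of "\<lambda>j i. f i j" "count_space UNIV"]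
  by (simp add: nn_integral_count_space_nat)

text \<open>For nonnegative terms the sum in \<open>ennreal\<close> determines both convergence and
  value. Sums can therefore be exchanged in \<open>ennreal\<close>, free of convergence conditions,
  and the result carried back to \<open>sums\<close>.\<close>

lemma sums_nonneg_cong_ennreal:
  fixes f g :: "nat \<Rightarrow> real"
  assumes f: "\<And>n. 0 \<le> f n" and g: "\<And>n. 0 \<le> g n"
    and eq: "(\<Sum>n. ennreal (f n)) = (\<Sum>n. ennreal (g n))"
  shows "f sums S \<longleftrightarrow> g sums S"
proof -
  have *: "v sums S" if u: "\<And>n. 0 \<le> u n" and v: "\<And>n. 0 \<le> v n"
    and e: "(\<Sum>n. ennreal (u n)) = (\<Sum>n. ennreal (v n))" and s: "u sums S" for u v :: "nat \<Rightarrow> real"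
  proof -
    have S: "0 \<le> S" using s u sums_le[OF _ sums_zero s] by simp
    have E: "(\<Sum>n. ennreal (v n)) = ennreal S" using suminf_ennreal_eq[OF u s] e by simp
    then have "summable v" by (intro summable_suminf_not_top v) simp
    then have "ennreal (suminf v) = ennreal S" using suminf_ennreal2[OF v] E by simp
    then have "suminf v = S" using S v \<open>summable v\<close> by (simp add: suminf_nonneg)
    then show ?thesis using \<open>summable v\<close> by (simp add: sums_iff)
  qed
  show ?thesis using *[OF f g eq] *[OF g f eq[symmetric]] by blast
qed

text \<open>With k = j + i + 1, both sides are the double sum of v k * s^(k-1-j) * y j over j < k,
  taken in the two possible orders (Tonelli). General weights \<open>y\<close> cover powers of x as
  well as integrals of such powers.\<close>

lemma sums_tail_coeff_iff:
  fixes v y :: "nat \<Rightarrow> real"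
  assumes v: "\<And>k. 0 \<le> v k" and s: "0 \<le> s" and y: "\<And>j. 0 \<le> y j"
    and sm: "\<And>j. summable (\<lambda>i. v (j + i + 1) * s ^ i)"
  shows "(\<lambda>j. tail_coeff s v j * y j) sums S \<longleftrightarrow>
         (\<lambda>k. v k * (\<Sum>j<k. s ^ (k - 1 - j) * y j)) sums S"
proof (rule sums_nonneg_cong_ennreal)
  have "(\<Sum>j. ennreal (tail_coeff s v j * y j)) =
        (\<Sum>j. \<Sum>k. if j < k then ennreal (v k * s ^ (k - 1 - j) * y j) else 0)"
  proof (rule suminf_cong)
    fix j
    have "(\<lambda>i. v (j + i + 1) * s ^ i * y j) sums (tail_coeff s v j * y j)"
      unfolding tail_coeff_def by (intro sums_mult2 summable_sums sm)
    then have "ennreal (tail_coeff s v j * y j) = (\<Sum>i. ennreal (v (j + i + 1) * s ^ i * y j))"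
      using v s y by (intro suminf_ennreal_eq[symmetric]) auto
    also have "\<dots> = (\<Sum>i. if j < i + (j + 1)
        then ennreal (v (i + (j + 1)) * s ^ (i + (j + 1) - 1 - j) * y j) else 0)"
      by (simp add: ac_simps)
    \<comment> \<open>Reindexing by k = i + (j + 1) drops only the terms with k at most j, and these
      vanish.\<close>
    also have "\<dots> = (\<Sum>k. if j < k then ennreal (v k * s ^ (k - 1 - j) * y j) else 0)"
      by (subst suminf_offset[of _ "j + 1"]) auto
    finally show "ennreal (tail_coeff s v j * y j) = \<dots>" .
  qed
  also have "\<dots> = (\<Sum>k. \<Sum>j. if j < k then ennreal (v k * s ^ (k - 1 - j) * y j) else 0)"
    by (rule suminf_ennreal_swap)
  also have "\<dots> = (\<Sum>k. ennreal (v k * (\<Sum>j<k. s ^ (k - 1 - j) * y j)))"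
  proof (rule suminf_cong)
    fix k
    have "(\<Sum>j. if j < k then ennreal (v k * s ^ (k - 1 - j) * y j) else 0) =
          (\<Sum>j<k. ennreal (v k * s ^ (k - 1 - j) * y j))"
      by (subst suminf_finite[of "{..<k}"]) auto
    also have "\<dots> = ennreal (v k * (\<Sum>j<k. s ^ (k - 1 - j) * y j))"
      using v s y by (subst sum_ennreal) (auto simp: sum_distrib_left mult.assoc)
    finally show "(\<Sum>j. if j < k then ennreal (v k * s ^ (k - 1 - j) * y j) else 0) = \<dots>" .
  qed
  finally show "(\<Sum>j. ennreal (tail_coeff s v j * y j)) = \<dots>" .
qed (use assms tail_coeff_nonneg in \<open>auto intro!: mult_nonneg_nonneg sum_nonneg\<close>)

lemma summable_tail_coeff_iff:
  fixes v y :: "nat \<Rightarrow> real"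
  assumes "\<And>k. 0 \<le> v k" "0 \<le> s" "\<And>j. 0 \<le> y j"
    and "\<And>j. summable (\<lambda>i. v (j + i + 1) * s ^ i)"
  shows "summable (\<lambda>j. tail_coeff s v j * y j) \<longleftrightarrow>
         summable (\<lambda>k. v k * (\<Sum>j<k. s ^ (k - 1 - j) * y j))"
proof -
  have "(sums) (\<lambda>j. tail_coeff s v j * y j) = (sums) (\<lambda>k. v k * (\<Sum>j<k. s ^ (k - 1 - j) * y j))"
    by (rule ext) (rule sums_tail_coeff_iff[OF assms])
  then show ?thesis by (simp only: summable_def)
qed

lemma suminf_tail_coeff:
  fixes v y :: "nat \<Rightarrow> real"
  assumes "\<And>k. 0 \<le> v k" "0 \<le> s" "\<And>j. 0 \<le> y j"
    and "\<And>j. summable (\<lambda>i. v (j + i + 1) * s ^ i)"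
  shows "(\<Sum>j. tail_coeff s v j * y j) = (\<Sum>k. v k * (\<Sum>j<k. s ^ (k - 1 - j) * y j))"
proof -
  \<comment> \<open>Equality of the whole predicate transfers \<open>suminf\<close> even when
    neither series converges.\<close>
  have "(sums) (\<lambda>j. tail_coeff s v j * y j) = (sums) (\<lambda>k. v k * (\<Sum>j<k. s ^ (k - 1 - j) * y j))"
    by (rule ext) (rule sums_tail_coeff_iff[OF assms])
  then show ?thesis by (simp only: suminf_def)
qed

lemma summable_shift_le:
  fixes v :: "nat \<Rightarrow> real"
  assumes v: "\<And>k. 0 \<le> v k" and r: "0 < r" and sm: "summable (\<lambda>k. v k * r ^ k)"
    and s: "0 \<le> s" "s \<le> r"
  shows "summable (\<lambda>i. v (i + m) * s ^ i)"
proof (rule summable_comparison_test')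
  show "summable (\<lambda>i. (v (i + m) * r ^ (i + m)) * (1 / r ^ m))"
    by (intro summable_mult2 summable_ignore_initial_segment[OF sm])
  show "norm (v (n + m) * s ^ n) \<le> (v (n + m) * r ^ (n + m)) * (1 / r ^ m)" for n
    using v[of "n + m"] r s by (auto simp: power_add intro!: mult_left_mono power_mono)
qed

lemma sum_powers_diff:
  fixes x y :: real
  assumes "x \<noteq> y"
  shows "(\<Sum>j<k. y ^ (k - 1 - j) * x ^ j) = (y ^ k - x ^ k) / (y - x)"
  using power_diff_sumr2[of x k y] assms by (simp add: field_simps)

lemma sum_powers_same: "(\<Sum>j<k. (x::real) ^ (k - 1 - j) * x ^ j) = real k * x ^ (k - 1)"
  by (simp add: power_add[symmetric])

text \<open>In either order, v (k + j + 1) gets the weight sum of x^(k-1-i) * y^i over i < k, which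
  is symmetric in x and y. No quotient is formed, so s = t is covered too.\<close>

lemma tail_coeff_commute:
  assumes v: "\<And>k. 0 \<le> v k" and r: "0 < r" and sm: "summable (\<lambda>k. v k * r ^ k)"
    and s: "0 \<le> s" "s \<le> r" and t: "0 \<le> t" "t \<le> r"
  shows "tail_coeff s (tail_coeff t v) = tail_coeff t (tail_coeff s v)"
proof
  fix j
  have eq: "tail_coeff y (tail_coeff x v) j =
      (\<Sum>k. v (k + j + 1) * (\<Sum>i<k. x ^ (k - 1 - i) * y ^ i))"
    if x: "0 \<le> x" "x \<le> r" and y: "0 \<le> y" for x y
  proof -
    have "tail_coeff y (tail_coeff x v) j =
        (\<Sum>i. tail_coeff x (\<lambda>k. v (k + j + 1)) i * y ^ i)"
      by (simp add: tail_coeff_def algebra_simps)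
    also have "\<dots> = (\<Sum>k. v (k + j + 1) * (\<Sum>i<k. x ^ (k - 1 - i) * y ^ i))"
    proof (rule suminf_tail_coeff)
      show "summable (\<lambda>i. v (m + i + 1 + j + 1) * x ^ i)" for m
        using summable_shift_le[OF v r sm x, of "m + j + 2"] by (simp add: algebra_simps)
    qed (use v x y in auto)
    finally show ?thesis .
  qed
  have "(\<Sum>i<k. t ^ (k - 1 - i) * s ^ i) = (\<Sum>i<k. s ^ (k - 1 - i) * t ^ i)" for k
    by (subst sum.nat_diff_reindex[symmetric]) (auto intro!: sum.cong)
  then show "tail_coeff s (tail_coeff t v) j = tail_coeff t (tail_coeff s v) j"
    using eq[OF t s(1)] eq[OF s t(1)] by simp
qed

text \<open>For s < r the weights (r^k - s^k)/(r - s) are at most a constant times r^k, so dividing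
  out s preserves convergence at r. For s = r the weights would be k * r^(k-1) instead.\<close>

lemma summable_tail_coeff_less:
  assumes v: "\<And>k. 0 \<le> v k" and r: "0 < r" and sm: "summable (\<lambda>k. v k * r ^ k)"
    and s: "0 \<le> s" "s < r"
  shows "summable (\<lambda>j. tail_coeff s v j * r ^ j)"
proof (subst summable_tail_coeff_iff)
  show "summable (\<lambda>i. v (j + i + 1) * s ^ i)" for j
    using summable_shift_le[OF v r sm s(1), of "j + 1"] s(2) by (simp add: algebra_simps)
  have "summable (\<lambda>k. v k * r ^ k * (1 / (r - s)))" by (intro summable_mult2 sm)
  then show "summable (\<lambda>k. v k * (\<Sum>j<k. s ^ (k - 1 - j) * r ^ j))"
  proof (rule summable_comparison_test')
    fix k
    have "(\<Sum>j<k. s ^ (k - 1 - j) * r ^ j) = (r ^ k - s ^ k) / (r - s)"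
      using s sum_powers_diff[of r s k] by (simp add: field_simps)
    also have "\<dots> \<le> r ^ k / (r - s)" using s by (intro divide_right_mono) auto
    finally have "(\<Sum>j<k. s ^ (k - 1 - j) * r ^ j) \<le> r ^ k * (1 / (r - s))" by simp
    from mult_left_mono[OF this v[of k]]
    show "norm (v k * (\<Sum>j<k. s ^ (k - 1 - j) * r ^ j)) \<le> v k * r ^ k * (1 / (r - s))"
      using v[of k] s r by (simp add: abs_mult sum_nonneg mult.assoc)
  qed
qed (use v s r in auto)

section \<open>Tail generating functions by removing one argument at a time\<close>

text \<open>Stronger than an equation for \<open>tail_gf\<close>, since \<open>infsum\<close> is 0 on families that are not summable.\<close>

definition has_tail_gf :: "(nat \<Rightarrow> real) \<Rightarrow> real list \<Rightarrow> real \<Rightarrow> bool" where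
  "has_tail_gf v ss S \<longleftrightarrow>
     ((\<lambda>i. v (sum_list i + length ss - 1) * (\<Prod>j<length ss. (ss ! j) ^ (i ! j))) has_sum S)
       {i. length i = length ss}"

lemma tail_gf_eqI: "has_tail_gf v ss S \<Longrightarrow> tail_gf v ss = S"
  unfolding has_tail_gf_def tail_gf_def by (rule infsumI)

lemma has_tail_gf_singleton:
  assumes "\<And>k. 0 \<le> v k" "0 \<le> x" "(\<lambda>j. v j * x ^ j) sums S"
  shows "has_tail_gf v [x] S"
proof -
  have set: "{i :: nat list. length i = length [x]} = (\<lambda>j. [j]) ` UNIV"
    by (auto simp: length_Suc_conv)
  have "((\<lambda>j. v j * x ^ j) has_sum S) UNIV"
    using assms by (intro sums_nonneg_imp_has_sum) auto
  then show ?thesis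
    unfolding has_tail_gf_def set
    by (subst has_sum_reindex) (auto simp: inj_on_def o_def)
qed

text \<open>Split an index list into its head h and its tail t. Summing over h for fixed t produces
  exactly \<open>tail_coeff s v\<close>, and the extra 1 in its index accounts for the list being
  one entry longer.\<close>

lemma has_tail_gf_Cons:
  assumes v: "\<And>k. 0 \<le> v k" and s: "0 \<le> s" and ss: "\<And>x. x \<in> set ss \<Longrightarrow> 0 \<le> x" "ss \<noteq> []"
    and sm: "\<And>j. summable (\<lambda>i. v (j + i + 1) * s ^ i)"
    and S: "has_tail_gf (tail_coeff s v) ss S"
  shows "has_tail_gf v (s # ss) S"
proof -
  define n where "n = length ss"
  \<comment> \<open>For n = 0 the truncated subtraction in \<open>sum_list t + n - 1\<close> would
    break the index identity used in \<open>inner\<close>.\<close>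
  have n: "n \<ge> 1" using ss(2) by (cases ss) (auto simp: n_def)
  define P where "P t = (\<Prod>j<n. (ss ! j) ^ (t ! j))" for t :: "nat list"
  have P: "0 \<le> P t" for t
    unfolding P_def using ss(1) by (intro prod_nonneg) (auto simp: n_def)
  define f where "f = (\<lambda>(t, h). v (h + sum_list t + n) * (s ^ h * P t))"
  have f_nonneg: "0 \<le> f z" for z
    using v s P by (auto simp: f_def split: prod.splits)
  have inner: "((\<lambda>h. f (t, h)) has_sum (tail_coeff s v (sum_list t + n - 1) * P t)) UNIV" for t
  proof (rule sums_nonneg_imp_has_sum)
    show "(\<lambda>h. f (t, h)) sums (tail_coeff s v (sum_list t + n - 1) * P t)"
      using sums_mult2[OF summable_sums[OF sm[of "sum_list t + n - 1"]], of "P t"] n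
      by (simp add: f_def tail_coeff_def algebra_simps)
  qed (rule f_nonneg)
  have outer: "((\<lambda>t. tail_coeff s v (sum_list t + n - 1) * P t) has_sum S) {t. length t = n}"
    using S by (simp add: has_tail_gf_def n_def P_def)
  \<comment> \<open>\<open>has_sum_SigmaI\<close> requires summability over pairs; by nonnegativity
    it follows from the iterated sums.\<close>
  have "(\<lambda>z. norm (f z)) summable_on (SIGMA t : {t. length t = n}. UNIV)"
  proof (subst Infinite_Sum.abs_summable_on_Sigma_iff, intro conjI ballI)
    show "(\<lambda>h. norm (f (t, h))) summable_on UNIV" for t
      using inner[of t] f_nonneg by (auto simp: summable_on_def)
    have "(\<Sum>\<^sub>\<infinity>h. norm (f (t, h))) = tail_coeff s v (sum_list t + n - 1) * P t" for t
      using infsumI[OF inner[of t]] f_nonneg by simp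
    then show "(\<lambda>t. norm (\<Sum>\<^sub>\<infinity>h. norm (f (t, h)))) summable_on {t. length t = n}"
      using outer P tail_coeff_nonneg[OF v s sm] by (auto simp: summable_on_def abs_mult)
  qed
  then have "f summable_on (SIGMA t : {t. length t = n}. UNIV)"
    by (rule abs_summable_summable)
  with inner outer have *: "(f has_sum S) (SIGMA t : {t. length t = n}. UNIV)"
    by (intro has_sum_SigmaI) auto
  have set: "{i. length i = length (s # ss)} =
      (\<lambda>(t, h). h # t) ` (SIGMA t : {t. length t = n}. (UNIV :: nat set))"
    by (auto simp: length_Suc_conv n_def image_iff)
  have "((\<lambda>i. v (sum_list i + length (s # ss) - 1) *
        (\<Prod>j<length (s # ss). ((s # ss) ! j) ^ (i ! j))) \<circ> (\<lambda>(t, h). h # t)) = f"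
    by (auto simp: f_def P_def n_def fun_eq_iff prod.lessThan_Suc_shift simp del: prod.lessThan_Suc)
  then show ?thesis
    unfolding has_tail_gf_def set using *
    by (subst has_sum_reindex) (auto simp: inj_on_def)
qed

section \<open>Power series with nonnegative coefficients, up to the endpoint r\<close>

text \<open>The series at r is a Weierstrass majorant on all of [0,r], so continuity includes r even
  if r is the radius of convergence.\<close>

lemma continuous_on_power_series_nonneg:
  fixes v :: "nat \<Rightarrow> real"
  assumes v: "\<And>k. 0 \<le> v k" and sm: "summable (\<lambda>k. v k * r ^ k)"
  shows "continuous_on {0..r} (\<lambda>x. \<Sum>k. v k * x ^ k)"
proof (rule uniform_limit_theorem)
  show "uniform_limit {0..r} (\<lambda>n x. \<Sum>k<n. v k * x ^ k) (\<lambda>x. \<Sum>k. v k * x ^ k) sequentially"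
    using v by (intro Weierstrass_m_test[OF _ sm])
      (auto simp: abs_mult intro!: mult_left_mono power_mono)
qed (auto intro!: always_eventually continuous_intros)

lemma summable_power_series_nonneg:
  fixes v :: "nat \<Rightarrow> real"
  assumes "\<And>k. 0 \<le> v k" "summable (\<lambda>k. v k * r ^ k)" "0 \<le> x" "x \<le> r"
  shows "summable (\<lambda>k. v k * x ^ k)"
  by (rule summable_comparison_test'[OF assms(2)])
    (use assms in \<open>auto simp: abs_mult intro!: mult_left_mono power_mono\<close>)

lemma power_series_nonneg_mono:
  fixes v :: "nat \<Rightarrow> real"
  assumes v: "\<And>k. 0 \<le> v k" and sm: "summable (\<lambda>k. v k * r ^ k)" and x: "0 \<le> x" "x \<le> y" "y \<le> r"
  shows "(\<Sum>k. v k * x ^ k) \<le> (\<Sum>k. v k * y ^ k)"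
  using assms by (intro suminf_le mult_left_mono power_mono summable_power_series_nonneg[OF v sm]) auto

lemma power_series_nonneg_strict_mono:
  fixes v :: "nat \<Rightarrow> real"
  assumes v: "\<And>k. 0 \<le> v k" and sm: "summable (\<lambda>k. v k * r ^ k)" and x: "0 \<le> x" "x < r"
    and n: "0 < v n" "0 < n"
  shows "(\<Sum>k. v k * x ^ k) < (\<Sum>k. v k * r ^ k)"
proof -
  have sx: "summable (\<lambda>k. v k * x ^ k)" using summable_power_series_nonneg[OF v sm] x by simp
  have "0 < (\<Sum>k. v k * r ^ k - v k * x ^ k)"
  proof (rule suminf_pos2)
    show "0 \<le> v k * r ^ k - v k * x ^ k" for k
      using v x by (simp add: mult_left_mono power_mono)
    show "0 < v n * r ^ n - v n * x ^ n"
      using n x by (simp add: power_strict_mono)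
  qed (intro summable_diff sm sx)
  then show ?thesis using suminf_diff[OF sm sx] by simp
qed

lemma power_series_nonneg_ge_coeff_0:
  fixes v :: "nat \<Rightarrow> real"
  assumes v: "\<And>k. 0 \<le> v k" and sm: "summable (\<lambda>k. v k * r ^ k)" and x: "0 \<le> x" "x \<le> r"
  shows "v 0 \<le> (\<Sum>k. v k * x ^ k)"
  using sum_le_suminf[OF summable_power_series_nonneg[OF v sm x], of "{0}"] v x by simp

lemma tail_coeff_ge:
  assumes v: "\<And>k. 0 \<le> v k" and s: "0 \<le> s" and sm: "\<And>j. summable (\<lambda>i. v (j + i + 1) * s ^ i)"
  shows "v (j + i + 1) * s ^ i \<le> tail_coeff s v j"
  unfolding tail_coeff_def using sum_le_suminf[OF sm, of "{i}"] v s by auto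

lemma sums_diffs_iff:
  "(\<lambda>k. diffs p k * x ^ k) sums S \<longleftrightarrow> (\<lambda>k. p k * (real k * x ^ (k - 1))) sums (S :: real)"
  using sums_Suc_iff[of "\<lambda>k. p k * (real k * x ^ (k - 1))" S]
  by (simp add: diffs_def mult_ac)

section \<open>Divided differences of an extendable generating function\<close>

locale extendable_pgf =
  fixes p :: "nat \<Rightarrow> real" and q r :: real
  assumes pgf: "defective_pgf p"
    and extendable: "extendable q r p"
    and fin: "pgf_deriv_finite p r"
begin

lemma p_nonneg: "0 \<le> p k"
  using pgf by (simp add: defective_pgf_def)

lemma q_nonneg: "0 \<le> q" and q_less_r: "q < r" and r_pos: "0 < r"
  using extendable by (auto simp: extendable_def)

lemma sums_p: "(\<lambda>k. p k * q ^ k) sums q" "(\<lambda>k. p k * r ^ k) sums r"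
  using extendable by (auto simp: extendable_def)

lemma summable_p: "summable (\<lambda>k. p k * r ^ k)"
  using sums_p(2) by (rule sums_summable)

lemma summable_deriv: "summable (\<lambda>k. p k * (real k * r ^ (k - 1)))"
  using fin sums_diffs_iff[of p r] by (auto simp: pgf_deriv_finite_def summable_def)

text \<open>Otherwise f would be affine with the two distinct fixed points q and r, hence the
  identity, contradicting p 1 being different from 1.\<close>

lemma ex_p_pos: obtains n where "2 \<le> n" "0 < p n"
proof -
  have "\<exists>n\<ge>2. p n \<noteq> 0"
  proof (rule ccontr)
    assume "\<not> ?thesis"
    then have z: "p n = 0" if "n \<ge> 2" for n using that by auto
    have "(\<lambda>k. p k * x ^ k) sums (p 0 + p 1 * x)" for x
      using sums_finite[of "{0,1}" "\<lambda>k. p k * x ^ k"] z by auto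
    then have "p 0 + p 1 * q = q" "p 0 + p 1 * r = r"
      using sums_p sums_unique2 by blast+
    then have "p 1 * (r - q) = r - q" by (simp add: algebra_simps)
    then show False using q_less_r pgf by (simp add: defective_pgf_def)
  qed
  then show ?thesis using that p_nonneg by (metis less_eq_real_def)
qed

lemma summable_p_shift: "0 \<le> s \<Longrightarrow> s \<le> r \<Longrightarrow> summable (\<lambda>i. p (j + i + 1) * s ^ i)"
  using summable_shift_le[OF p_nonneg r_pos summable_p, of s "j + 1"] by (simp add: algebra_simps)

text \<open>The coefficient sequences of $f^{(2)}(q,\cdot)$, $f^{(2)}(r,\cdot)$, $f^{(3)}(q,r,\cdot)$,
  $f^{(4)}(q,q,r,\cdot)$ and $f^{(4)}(q,r,r,\cdot)$.\<close>

definition a where "a = tail_coeff q p"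
definition c where "c = tail_coeff r p"
definition b where "b = tail_coeff q c"
definition d where "d = tail_coeff q b"
definition W where "W = tail_coeff r b"

lemma a_nonneg: "0 \<le> a j" and c_nonneg: "0 \<le> c j"
  unfolding a_def c_def using p_nonneg q_nonneg q_less_r r_pos summable_p_shift
  by (intro tail_coeff_nonneg; simp)+

lemma summable_a: "summable (\<lambda>j. a j * r ^ j)"
  unfolding a_def by (rule summable_tail_coeff_less) (use p_nonneg r_pos summable_p q_nonneg q_less_r in auto)

text \<open>Dividing out r gives p k the weight k * r^(k-1); this is where finiteness of f'(r)
  enters.\<close>

lemma summable_c: "summable (\<lambda>j. c j * r ^ j)"
  unfolding c_def
  by (subst summable_tail_coeff_iff; (unfold sum_powers_same)?)
    (use p_nonneg r_pos summable_p_shift summable_deriv in auto)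

lemma summable_c_shift: "0 \<le> s \<Longrightarrow> s \<le> r \<Longrightarrow> summable (\<lambda>i. c (j + i + 1) * s ^ i)"
  using summable_shift_le[OF c_nonneg r_pos summable_c, of s "j + 1"] by (simp add: algebra_simps)

lemma summable_a_shift: "0 \<le> s \<Longrightarrow> s \<le> r \<Longrightarrow> summable (\<lambda>i. a (j + i + 1) * s ^ i)"
  using summable_shift_le[OF a_nonneg r_pos summable_a, of s "j + 1"] by (simp add: algebra_simps)

lemma b_nonneg: "0 \<le> b j"
  unfolding b_def using c_nonneg q_nonneg q_less_r summable_c_shift
  by (intro tail_coeff_nonneg; simp)

text \<open>Both orders are used: removing r first yields convergence at r through
  \<open>summable_c\<close>, while removing q first matches the argument list [q, r, x].\<close>

lemma b_eq: "b = tail_coeff r a"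
  unfolding b_def c_def a_def
  by (rule tail_coeff_commute[OF p_nonneg r_pos summable_p]) (use q_nonneg q_less_r in auto)

lemma summable_b: "summable (\<lambda>j. b j * r ^ j)"
  unfolding b_def by (rule summable_tail_coeff_less) (use c_nonneg r_pos summable_c q_nonneg q_less_r in auto)

lemma summable_b_shift: "0 \<le> s \<Longrightarrow> s \<le> r \<Longrightarrow> summable (\<lambda>i. b (j + i + 1) * s ^ i)"
  using summable_shift_le[OF b_nonneg r_pos summable_b, of s "j + 1"] by (simp add: algebra_simps)

lemma d_nonneg: "0 \<le> d j" and W_nonneg: "0 \<le> W j"
  unfolding d_def W_def using b_nonneg q_nonneg q_less_r r_pos summable_b_shift
  by (intro tail_coeff_nonneg; simp)+

lemma summable_d: "summable (\<lambda>j. d j * r ^ j)"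
  unfolding d_def by (rule summable_tail_coeff_less) (use b_nonneg r_pos summable_b q_nonneg q_less_r in auto)

text \<open>Some p n > 0 with n at least 2 contributes to a (n - 1) with factor q^0, which is
  harmless if q = 0, and a (n - 1) contributes to b 0 with factor r^(n-2) > 0.\<close>

lemma b_0_pos: "0 < b 0"
proof -
  obtain n where n: "2 \<le> n" "0 < p n" by (rule ex_p_pos)
  have "p (n - 1 + 0 + 1) * q ^ 0 \<le> a (n - 1)"
    unfolding a_def by (rule tail_coeff_ge) (use p_nonneg q_nonneg q_less_r summable_p_shift in auto)
  then have "0 < a (n - 1)" using n by simp
  moreover have "a (0 + (n - 2) + 1) * r ^ (n - 2) \<le> b 0"
    unfolding b_eq by (rule tail_coeff_ge) (use a_nonneg r_pos summable_a_shift in auto)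
  moreover have "0 + (n - 2) + 1 = n - 1" using n by simp
  ultimately show ?thesis using r_pos
    by (metis zero_less_mult_iff zero_less_power less_le_trans)
qed

text \<open>The divided difference of f at s, evaluated at s itself, is the derivative: the weight
  of p k becomes k * s^(k-1).\<close>

lemma pgf_deriv_eq:
  assumes "0 \<le> s" "s \<le> r"
  shows "pgf_deriv p s = (\<Sum>j. tail_coeff s p j * s ^ j)"
proof -
  have eq: "(\<lambda>k. diffs p k * s ^ k) sums S \<longleftrightarrow> (\<lambda>j. tail_coeff s p j * s ^ j) sums S" for S
    unfolding sums_diffs_iff
    by (subst sums_tail_coeff_iff; (unfold sum_powers_same)?)
      (use p_nonneg assms summable_p_shift in auto)
  have "(sums) (\<lambda>k. diffs p k * s ^ k) = (sums) (\<lambda>j. tail_coeff s p j * s ^ j)"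
    by (rule ext) (rule eq)
  then show ?thesis by (simp only: pgf_deriv_def suminf_def)
qed

text \<open>The chord of f between its fixed points q and r has slope 1.\<close>

lemma sums_slope: "(\<lambda>k. p k * ((r ^ k - q ^ k) / (r - q))) sums 1"
proof -
  have "(\<lambda>k. (p k * r ^ k - p k * q ^ k) * (1 / (r - q))) sums ((r - q) * (1 / (r - q)))"
    by (intro sums_mult2 sums_diff sums_p)
  then show ?thesis using q_less_r by (simp add: algebra_simps diff_divide_distrib)
qed

text \<open>Strict convexity gives f'(q) < 1 < f'(r). The series of \<open>a\<close> is f'(q) at q
  and the chord slope 1 at r; the series of \<open>c\<close> is 1 at q and f'(r) at r. Both increase
  strictly, having a positive coefficient of positive index n - 1.\<close>

lemma gamma_pos: "0 < gamma_qr p q r"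
proof -
  obtain n where n: "2 \<le> n" "0 < p n" by (rule ex_p_pos)
  have ge: "p (n - 1 + 0 + 1) * s ^ 0 \<le> tail_coeff s p (n - 1)" if "0 \<le> s" "s \<le> r" for s
    by (rule tail_coeff_ge) (use p_nonneg that summable_p_shift in auto)
  have pos: "0 < a (n - 1)" "0 < c (n - 1)" "0 < n - 1"
    using ge[of q] ge[of r] n q_nonneg q_less_r r_pos by (auto simp: a_def c_def)
  have "(q ^ k - r ^ k) / (q - r) = (r ^ k - q ^ k) / (r - q)" for k
    using minus_divide_divide[of "r ^ k - q ^ k" "r - q"] by simp
  then have "(\<lambda>j. a j * r ^ j) sums 1"
    unfolding a_def
    by (subst sums_tail_coeff_iff; (subst sum_powers_diff)?)
      (use p_nonneg q_nonneg q_less_r r_pos summable_p_shift sums_slope in auto)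
  moreover have "(\<lambda>j. c j * q ^ j) sums 1"
    unfolding c_def
    by (subst sums_tail_coeff_iff; (subst sum_powers_diff)?)
      (use p_nonneg q_nonneg q_less_r r_pos summable_p_shift sums_slope in auto)
  ultimately have "(\<Sum>j. a j * r ^ j) = 1" "(\<Sum>j. c j * q ^ j) = 1" by (simp_all add: sums_iff)
  moreover have "(\<Sum>j. a j * q ^ j) < (\<Sum>j. a j * r ^ j)" "(\<Sum>j. c j * q ^ j) < (\<Sum>j. c j * r ^ j)"
    using power_series_nonneg_strict_mono[OF a_nonneg summable_a q_nonneg q_less_r pos(1,3)]
      power_series_nonneg_strict_mono[OF c_nonneg summable_c q_nonneg q_less_r pos(2,3)] by auto
  ultimately show ?thesis
    using pgf_deriv_eq[of q] pgf_deriv_eq[of r] q_nonneg q_less_r r_pos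
    by (simp add: gamma_qr_def a_def c_def)
qed

definition g where "g x = (\<Sum>j. b j * x ^ j)"
definition e where "e x = (\<Sum>j. d j * x ^ j)"
definition w where "w x = (g r - g x) / (r - x)"

text \<open>The point r is excluded because the series there is g'(r), possibly infinite, whereas
  \<open>w r\<close> is 0 by the convention for division by 0.\<close>

lemma sums_W:
  assumes x: "0 \<le> x" "x < r"
  shows "(\<lambda>j. W j * x ^ j) sums w x"
  unfolding W_def
proof (subst sums_tail_coeff_iff)
  have "(\<lambda>k. (b k * r ^ k - b k * x ^ k) * (1 / (r - x))) sums ((g r - g x) * (1 / (r - x)))"
    unfolding g_def
    using x by (intro sums_mult2 sums_diff summable_sums summable_power_series_nonneg[OF b_nonneg summable_b]) auto
  then show "(\<lambda>k. b k * (\<Sum>j<k. r ^ (k - 1 - j) * x ^ j)) sums w x"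
    using x by (subst sum_powers_diff) (auto simp: w_def algebra_simps diff_divide_distrib)
qed (use b_nonneg r_pos x summable_b_shift in auto)

lemma psi_eq:
  assumes x: "0 \<le> x" "x < r"
  shows "psi_qr p q r x = (e x - gamma_qr p q r * w x) / g x"
proof -
  have le: "q \<le> r" "0 \<le> r" "x \<le> r" using q_less_r r_pos x by auto
  \<comment> \<open>The argument list [q, q, r, x] removes r last, whereas \<open>d\<close> removes
    it before the second q.\<close>
  have dr: "tail_coeff r (tail_coeff q a) = d"
    unfolding d_def b_eq
    by (rule tail_coeff_commute[OF a_nonneg r_pos summable_a]) (use q_nonneg le in auto)
  have sqa: "summable (\<lambda>j. tail_coeff q a j * r ^ j)"
    by (rule summable_tail_coeff_less[OF a_nonneg r_pos summable_a q_nonneg q_less_r])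
  have qa: "0 \<le> tail_coeff q a j" for j
    by (rule tail_coeff_nonneg[OF a_nonneg q_nonneg summable_a_shift[OF q_nonneg le(1)]])
  have qas: "summable (\<lambda>i. tail_coeff q a (j + i + 1) * r ^ i)" for j
    using summable_shift_le[OF qa r_pos sqa le(2) order.refl, of "j + 1"] by (simp add: algebra_simps)
  have sg: "(\<lambda>j. b j * x ^ j) sums g x" unfolding g_def
    by (intro summable_sums summable_power_series_nonneg[OF b_nonneg summable_b x(1) le(3)])
  have se: "(\<lambda>j. d j * x ^ j) sums e x" unfolding e_def
    by (intro summable_sums summable_power_series_nonneg[OF d_nonneg summable_d x(1) le(3)])
  have p_q: "has_tail_gf p (q # ss) S" if "has_tail_gf a ss S" "ss \<noteq> []" "\<forall>y\<in>set ss. 0 \<le> y" for ss S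
    using that has_tail_gf_Cons[OF p_nonneg q_nonneg _ _ summable_p_shift[OF q_nonneg le(1)]]
    by (simp add: a_def)
  have a_r: "has_tail_gf a (r # ss) S" if "has_tail_gf b ss S" "ss \<noteq> []" "\<forall>y\<in>set ss. 0 \<le> y" for ss S
    using that has_tail_gf_Cons[OF a_nonneg le(2) _ _ summable_a_shift[OF le(2) order.refl]]
    by (simp add: b_eq)
  have "has_tail_gf p [q, r, x] (g x)"
    using x le by (intro p_q a_r has_tail_gf_singleton[OF b_nonneg x(1) sg]) auto
  moreover have "has_tail_gf b [r, x] (w x)"
    by (rule has_tail_gf_Cons[OF b_nonneg le(2) _ _ summable_b_shift[OF le(2) order.refl]])
      (use has_tail_gf_singleton[OF W_nonneg x(1) sums_W[OF x]] x in \<open>auto simp: W_def\<close>)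
  then have "has_tail_gf p [q, r, r, x] (w x)"
    using x le by (intro p_q a_r) auto
  moreover have "has_tail_gf (tail_coeff q a) [r, x] (e x)"
    by (rule has_tail_gf_Cons[OF qa le(2) _ _ qas])
      (use has_tail_gf_singleton[OF d_nonneg x(1) se] x in \<open>auto simp: dr\<close>)
  then have "has_tail_gf a [q, r, x] (e x)"
    by (intro has_tail_gf_Cons[OF a_nonneg q_nonneg _ _ summable_a_shift[OF q_nonneg le(1)]])
      (use x le in auto)
  then have "has_tail_gf p [q, q, r, x] (e x)"
    using x le q_nonneg by (intro p_q) auto
  ultimately show ?thesis by (simp add: psi_qr_def tail_gf_eqI)
qed

end

section \<open>Harmonic sums\<close>

lemma harm_eq_sum_lessThan: "harm k = (\<Sum>j<k. 1 / real (Suc j))"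
  by (induction k) (simp_all add: harm_Suc harm_def inverse_eq_divide)

text \<open>The discrete form of integrating ln x to x ln x - x; the factor k ln k originates
  here.\<close>

lemma sum_harm: "(\<Sum>j<k. harm j) = real k * harm k - real k"
proof (induction k)
  case (Suc k)
  have "real (Suc k) * inverse (real (Suc k)) = 1" by simp
  then have "real (Suc k) * harm (Suc k) = real (Suc k) * harm k + 1"
    unfolding harm_Suc distrib_left by simp
  with Suc show ?case by (simp add: algebra_simps)
qed (simp add: harm_def)

lemma harm_le_of_nat: "harm k \<le> real k"
  unfolding harm_eq_sum_lessThan
  using sum_bounded_above[of "{..<k}" "\<lambda>j. 1 / real (Suc j)" 1] by simp

text \<open>The difference of harmonic number and logarithm decreases from its value 1 at k =
  1.\<close>

lemma harm_le_Suc_ln: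
  assumes "0 < k"
  shows "harm k \<le> 1 + ln (real k)"
proof -
  obtain n where k: "k = Suc n" using assms gr0_implies_Suc by blast
  show ?thesis
    using decseqD[OF decseq_harm_diff_ln, of 0 n] by (simp add: k harm_def)
qed

lemma suminf_ennreal_finite_iff:
  assumes "\<And>n. 0 \<le> f n"
  shows "(\<Sum>n. ennreal (f n)) < \<infinity> \<longleftrightarrow> summable f"
proof
  assume "(\<Sum>n. ennreal (f n)) < \<infinity>"
  then show "summable f" using assms by (intro summable_suminf_not_top) (auto simp: less_top)
qed (use suminf_ennreal2[OF assms] in \<open>simp add: less_top\<close>)

section \<open>The integral of w and the k ln k condition\<close>

context extendable_pgf
begin

text \<open>Applying \<open>summable_tail_coeff_iff\<close> three times moves the weights of \<open>W\<close> that come from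
  $\int_0^r x^j\,dx$ to \<open>b\<close>, then to \<open>c\<close> as \<open>z\<close>, then to \<open>p\<close> as \<open>u\<close>.\<close>

definition z where "z k = (\<Sum>j<k. q ^ (k - 1 - j) * (r ^ j * harm j))" for k
definition u where "u k = (\<Sum>j<k. r ^ (k - 1 - j) * z j)" for k

lemma z_nonneg: "0 \<le> z k"
  unfolding z_def using q_nonneg r_pos by (intro sum_nonneg mult_nonneg_nonneg) (auto simp: harm_nonneg)

lemma u_nonneg: "0 \<le> u k"
  unfolding u_def using z_nonneg r_pos by (intro sum_nonneg) auto

text \<open>The kernel q^(k-1-j) * r^j is geometric with its mass near j = k, since q < r. So z k is
  of order r^k * harm k; \<open>z_ge\<close> gets the matching lower bound from the last term
  alone.\<close>

lemma z_le: "z k \<le> harm k * r ^ k / (r - q)"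
proof -
  have "z k \<le> (\<Sum>j<k. q ^ (k - 1 - j) * (r ^ j * harm k))"
    unfolding z_def using q_nonneg r_pos by (intro sum_mono mult_left_mono harm_mono) auto
  also have "\<dots> = (\<Sum>j<k. q ^ (k - 1 - j) * r ^ j) * harm k"
    by (simp add: sum_distrib_right mult.assoc)
  also have "\<dots> = (q ^ k - r ^ k) / (q - r) * harm k"
    using q_less_r by (subst sum_powers_diff) auto
  also have "\<dots> = (r ^ k - q ^ k) / (r - q) * harm k"
    using minus_divide_divide[of "r ^ k - q ^ k" "r - q"] by simp
  also have "\<dots> \<le> r ^ k / (r - q) * harm k"
    using q_nonneg q_less_r by (intro mult_right_mono divide_right_mono) (auto simp: harm_nonneg)
  finally show ?thesis by (simp add: mult_ac)
qed

lemma z_ge: "r ^ k * harm k \<le> z (Suc k)"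
proof -
  have "q ^ (k - k) * (r ^ k * harm k) \<le> z (Suc k)"
    unfolding z_def using q_nonneg r_pos
    by (intro order_trans[OF _ member_le_sum[of k]]) (auto simp: harm_nonneg)
  then show ?thesis by simp
qed

text \<open>Summing \<open>z_le\<close> gives the factor k * (harm k - 1), and the 1 cancels exactly
  against \<open>harm_le_Suc_ln\<close>.\<close>

lemma u_le:
  assumes "0 < k"
  shows "u k \<le> 1 / (r * (r - q)) * (r ^ k * real k * ln (real k))"
proof -
  have "u k \<le> (\<Sum>j<k. r ^ (k - 1) / (r - q) * harm j)"
    unfolding u_def
  proof (rule sum_mono)
    fix j assume "j \<in> {..<k}"
    then have "k - 1 = (k - 1 - j) + j" by simp
    then have pw: "r ^ (k - 1) = r ^ (k - 1 - j) * r ^ j" by (metis power_add)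
    have "r ^ (k - 1 - j) * z j \<le> r ^ (k - 1 - j) * (harm j * r ^ j / (r - q))"
      using r_pos z_le by (intro mult_left_mono) auto
    then show "r ^ (k - 1 - j) * z j \<le> r ^ (k - 1) / (r - q) * harm j"
      unfolding pw by (simp add: mult_ac)
  qed
  also have "\<dots> = r ^ (k - 1) / (r - q) * (real k * (harm k - 1))"
    unfolding sum_distrib_left[symmetric] sum_harm by (simp add: right_diff_distrib)
  also have "\<dots> \<le> r ^ (k - 1) / (r - q) * (real k * ln (real k))"
    using r_pos q_less_r harm_le_Suc_ln[OF assms] by (intro mult_left_mono) auto
  also have "\<dots> = 1 / (r * (r - q)) * (r ^ k * real k * ln (real k))"
    using assms r_pos by (cases k) auto
  finally show ?thesis .
qed

text \<open>The lower bound loses a term of order k * r^k. It is written with r^(k-1) so that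
  \<open>summable_deriv\<close> absorbs it.\<close>

lemma u_ge:
  assumes "2 \<le> k"
  shows "r ^ k * real k * ln (real k) \<le> r\<^sup>2 * u k + 2 * r * (real k * r ^ (k - 1))"
proof -
  obtain n where k: "k = Suc (Suc n)" using assms by (metis add_2_eq_Suc le_Suc_ex)
  \<comment> \<open>\<open>z_ge\<close> bounds z at a successor, so the sum over j < k is compared
    with one over j < m = k - 1.\<close>
  define m where "m = Suc n"
  have "r ^ n * (real m * harm m - real m) = (\<Sum>j<m. r ^ (m - Suc j) * (r ^ j * harm j))"
    unfolding sum_harm[symmetric] sum_distrib_left
  proof (rule sum.cong)
    fix j assume "j \<in> {..<m}"
    then have "n = (m - Suc j) + j" by (simp add: m_def)
    then have "r ^ n = r ^ (m - Suc j) * r ^ j" by (metis power_add)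
    then show "r ^ n * harm j = r ^ (m - Suc j) * (r ^ j * harm j)" by simp
  qed simp
  also have "\<dots> \<le> (\<Sum>j<m. r ^ (m - Suc j) * z (Suc j))"
    using r_pos z_ge by (intro sum_mono mult_left_mono) auto
  also have "\<dots> \<le> u k"
    unfolding u_def k m_def[symmetric] using r_pos z_nonneg[of 0]
    by (subst sum.lessThan_Suc_shift) simp
  finally have "r\<^sup>2 * (r ^ n * (real m * harm m - real m)) \<le> r\<^sup>2 * u k"
    by (intro mult_left_mono) auto
  then have 1: "r ^ k * (real m * harm m - real m) \<le> r\<^sup>2 * u k"
    by (simp add: k power2_eq_square mult_ac)
  have "real k * ln (real k) \<le> real k * harm m"
    using ln_le_harm[of m] by (intro mult_left_mono) (auto simp: k m_def add_ac)
  \<comment> \<open>Here k * harm m = m * harm m + harm m, and harm m is at most m.\<close>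
  also have "\<dots> \<le> (real m * harm m - real m) + 2 * real k"
    using harm_le_of_nat[of m] by (simp add: k m_def algebra_simps)
  finally have "r ^ k * (real k * ln (real k)) \<le> r ^ k * ((real m * harm m - real m) + 2 * real k)"
    using r_pos by (intro mult_left_mono) auto
  then have "r ^ k * (real k * ln (real k)) \<le> r\<^sup>2 * u k + 2 * (real k * r ^ k)"
    using 1 by (simp add: algebra_simps)
  moreover have "2 * r * (real k * r ^ (k - 1)) = 2 * (real k * r ^ k)" by (simp add: k)
  ultimately show ?thesis by (simp only: mult.assoc)
qed

lemma summable_W_iff_summable_u:
  "summable (\<lambda>j. W j * (r ^ Suc j / real (Suc j))) \<longleftrightarrow> summable (\<lambda>k. p k * u k)"
proof -
  \<comment> \<open>The powers combine to r^k for every j, leaving the first of the two nested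
    harmonic sums.\<close>
  have h: "(\<Sum>j<k. r ^ (k - 1 - j) * (r ^ Suc j / real (Suc j))) = r ^ k * harm k" for k
  proof -
    have "r ^ (k - 1 - j) * (r ^ Suc j / real (Suc j)) = r ^ k * (1 / real (Suc j))" if "j < k" for j
    proof -
      have "k - 1 - j + Suc j = k" using that by simp
      then have "r ^ (k - 1 - j) * r ^ Suc j = r ^ k" by (metis power_add)
      then show ?thesis by simp
    qed
    then show ?thesis by (simp add: harm_eq_sum_lessThan sum_distrib_left)
  qed
  have "summable (\<lambda>j. W j * (r ^ Suc j / real (Suc j))) \<longleftrightarrow> summable (\<lambda>k. b k * (r ^ k * harm k))"
    unfolding W_def using b_nonneg r_pos summable_b_shift
    by (subst summable_tail_coeff_iff; (subst h)?) auto
  also have "\<dots> \<longleftrightarrow> summable (\<lambda>k. c k * z k)"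
    unfolding b_def z_def using c_nonneg q_nonneg q_less_r r_pos summable_c_shift
    by (intro summable_tail_coeff_iff) (auto simp: harm_nonneg)
  also have "\<dots> \<longleftrightarrow> summable (\<lambda>k. p k * u k)"
    unfolding c_def u_def using p_nonneg r_pos summable_p_shift z_nonneg
    by (intro summable_tail_coeff_iff) auto
  finally show ?thesis .
qed

lemma summable_u_iff:
  "summable (\<lambda>k. p k * u k) \<longleftrightarrow> (\<lambda>k. p k * r ^ k * real k * ln (real k)) summable_on {2..}"
proof -
  let ?t = "\<lambda>k. p k * r ^ k * real k * ln (real k)"
  \<comment> \<open>The term vanishes at k = 0 through the factor k and at k = 1 through ln 1 = 0,
    so the sum may start at 0.\<close>
  have small: "?t k = 0" if "k \<notin> {2..}" for k
  proof -
    from that have "k = 0 \<or> k = 1" by auto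
    then show ?thesis by auto
  qed
  have nonneg: "0 \<le> ?t k" for k
    using p_nonneg[of k] r_pos by (cases "k = 0") auto
  have "?t summable_on {2..} \<longleftrightarrow> ?t summable_on UNIV"
    using small by (intro summable_on_cong_neutral) auto
  also have "\<dots> \<longleftrightarrow> summable ?t" by (rule summable_on_UNIV_nonneg_real_iff) (rule nonneg)
  also have "\<dots> \<longleftrightarrow> summable (\<lambda>k. p k * u k)"
  proof
    assume "summable ?t"
    then have "summable (\<lambda>k. 1 / (r * (r - q)) * ?t k)" by (rule summable_mult)
    then show "summable (\<lambda>k. p k * u k)"
    proof (rule summable_comparison_test')
      fix k
      show "norm (p k * u k) \<le> 1 / (r * (r - q)) * ?t k"
      proof (cases "k = 0")
        case False
        then show ?thesis
          using mult_left_mono[OF u_le[of k] p_nonneg[of k]] p_nonneg u_nonneg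
          by (simp add: abs_mult mult_ac)
      qed (simp add: u_def)
    qed
  next
    assume "summable (\<lambda>k. p k * u k)"
    then have "summable (\<lambda>k. r\<^sup>2 * (p k * u k) + 2 * r * (p k * (real k * r ^ (k - 1))))"
      by (intro summable_add summable_mult summable_deriv)
    then show "summable ?t"
    proof (rule summable_comparison_test'[where N = 2])
      fix k :: nat assume "2 \<le> k"
      from mult_left_mono[OF u_ge[OF this] p_nonneg[of k]]
      show "norm (?t k) \<le> r\<^sup>2 * (p k * u k) + 2 * r * (p k * (real k * r ^ (k - 1)))"
        using nonneg[of k] by (simp add: algebra_simps)
    qed
  qed
  finally show ?thesis by simp
qed

text \<open>Monotone convergence in \<open>ennreal\<close> keeps the identity valid when both sides
  are infinite.\<close>

lemma nn_integral_w:
  "(\<integral>\<^sup>+x\<in>{0..<r}. ennreal (w x) \<partial>lborel) = (\<Sum>j. ennreal (W j * (r ^ Suc j / real (Suc j))))"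
proof -
  have "(\<integral>\<^sup>+x\<in>{0..<r}. ennreal (w x) \<partial>lborel) =
      (\<integral>\<^sup>+x. (\<Sum>j. ennreal (W j * x ^ j) * indicator {0..<r} x) \<partial>lborel)"
  proof (rule nn_integral_cong)
    fix x
    show "ennreal (w x) * indicator {0..<r} x = (\<Sum>j. ennreal (W j * x ^ j) * indicator {0..<r} x)"
    proof (cases "x \<in> {0..<r}")
      case True
      then have "(\<Sum>j. ennreal (W j * x ^ j)) = ennreal (w x)"
        using W_nonneg by (intro suminf_ennreal_eq sums_W) auto
      with True show ?thesis by simp
    qed simp
  qed
  also have "\<dots> = (\<Sum>j. \<integral>\<^sup>+x. ennreal (W j * x ^ j) * indicator {0..<r} x \<partial>lborel)"
    by (rule nn_integral_suminf) simp
  also have "\<dots> = (\<Sum>j. ennreal (W j * (r ^ Suc j / real (Suc j))))"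
  proof (rule suminf_cong)
    fix j
    \<comment> \<open>The endpoint r is a null set; adding it permits the fundamental theorem on a
      closed interval.\<close>
    have "(\<integral>\<^sup>+x. ennreal (W j * x ^ j) * indicator {0..<r} x \<partial>lborel) =
        (\<integral>\<^sup>+x. ennreal (W j * x ^ j) * indicator {0..r} x \<partial>lborel)"
      using AE_lborel_singleton[of r]
      by (intro nn_integral_cong_AE) (auto elim!: eventually_mono simp: indicator_def)
    also have "\<dots> = ennreal (W j * (r ^ Suc j / real (Suc j)) - W j * (0 ^ Suc j / real (Suc j)))"
      using r_pos W_nonneg
      by (intro nn_integral_FTC_Icc[where F = "\<lambda>x. W j * (x ^ Suc j / real (Suc j))"])
        (auto intro!: derivative_eq_intros simp del: power_Suc)
    finally show "(\<integral>\<^sup>+x. ennreal (W j * x ^ j) * indicator {0..<r} x \<partial>lborel) =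
        ennreal (W j * (r ^ Suc j / real (Suc j)))" by simp
  qed
  finally show ?thesis .
qed

lemma nn_integral_w_finite_iff:
  "(\<integral>\<^sup>+x\<in>{0..<r}. ennreal (w x) \<partial>lborel) < \<infinity> \<longleftrightarrow>
   (\<lambda>k. p k * r ^ k * real k * ln (real k)) summable_on {2..}"
proof -
  have "0 \<le> W j * (r ^ Suc j / real (Suc j))" for j
    using W_nonneg[of j] r_pos by (intro mult_nonneg_nonneg) auto
  then show ?thesis
    unfolding nn_integral_w summable_u_iff[symmetric] summable_W_iff_summable_u[symmetric]
    by (rule suminf_ennreal_finite_iff)
qed

section \<open>Comparison of psi with w\<close>

abbreviation "\<gamma> \<equiv> gamma_qr p q r"
abbreviation "\<psi> \<equiv> psi_qr p q r"

lemma continuous_on_g: "continuous_on {0..r} g"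
  unfolding g_def by (rule continuous_on_power_series_nonneg[OF b_nonneg summable_b])

lemma continuous_on_e: "continuous_on {0..r} e"
  unfolding e_def by (rule continuous_on_power_series_nonneg[OF d_nonneg summable_d])

lemma g_ge: "0 \<le> x \<Longrightarrow> x \<le> r \<Longrightarrow> b 0 \<le> g x"
  unfolding g_def by (rule power_series_nonneg_ge_coeff_0[OF b_nonneg summable_b])

lemma g_pos: "0 \<le> x \<Longrightarrow> x \<le> r \<Longrightarrow> 0 < g x"
  using g_ge b_0_pos by force

lemma g_le: "0 \<le> x \<Longrightarrow> x \<le> r \<Longrightarrow> g x \<le> g r"
  unfolding g_def by (rule power_series_nonneg_mono[OF b_nonneg summable_b]) auto

lemma e_nonneg: "0 \<le> x \<Longrightarrow> x \<le> r \<Longrightarrow> 0 \<le> e x"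
  using power_series_nonneg_ge_coeff_0[OF d_nonneg summable_d, of x] d_nonneg[of 0]
  by (simp add: e_def)

lemma e_le: "0 \<le> x \<Longrightarrow> x \<le> r \<Longrightarrow> e x \<le> e r"
  unfolding e_def by (rule power_series_nonneg_mono[OF d_nonneg summable_d]) auto

lemma w_nonneg: "0 \<le> x \<Longrightarrow> x < r \<Longrightarrow> 0 \<le> w x"
  using g_le[of x] by (simp add: w_def)

lemma continuous_on_w: "continuous_on {0..<r} w"
  unfolding w_def
  by (intro continuous_intros continuous_on_subset[OF continuous_on_g]) auto

lemma continuous_on_psi: "continuous_on {0..<r} \<psi>"
proof -
  have "continuous_on {0..<r} (\<lambda>x. (e x - \<gamma> * w x) / g x)"
    using g_pos
    by (intro continuous_intros continuous_on_w continuous_on_subset[OF continuous_on_g]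
        continuous_on_subset[OF continuous_on_e]) (auto simp: less_le)
  then show ?thesis
    by (rule continuous_on_eq) (simp add: psi_eq)
qed

text \<open>Together with \<open>w_le_abs_psi\<close>, this bounds each of |psi| and w by an affine
  function of the other, so on a bounded interval they are integrable simultaneously.\<close>

lemma abs_psi_le:
  assumes x: "0 \<le> x" "x < r"
  shows "\<bar>\<psi> x\<bar> \<le> e r / b 0 + \<gamma> / b 0 * w x"
proof -
  have "\<bar>e x - \<gamma> * w x\<bar> \<le> e r + \<gamma> * w x"
    using e_nonneg[of x] e_le[of x] mult_nonneg_nonneg[OF less_imp_le[OF gamma_pos] w_nonneg[OF x]] x
    by linarith
  then have "\<bar>\<psi> x\<bar> \<le> (e r + \<gamma> * w x) / b 0"
    using g_ge[of x] g_pos[of x] b_0_pos x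
    by (simp add: psi_eq abs_divide) (intro frac_le; linarith)
  then show ?thesis by (simp add: add_divide_distrib)
qed

text \<open>Solve psi * g = e - gamma * w for w; this is possible because gamma > 0.\<close>

lemma w_le_abs_psi:
  assumes x: "0 \<le> x" "x < r"
  shows "w x \<le> e r / \<gamma> + g r / \<gamma> * \<bar>\<psi> x\<bar>"
proof -
  have "\<psi> x * g x = e x - \<gamma> * w x" using g_pos[of x] x by (simp add: psi_eq)
  then have "\<gamma> * w x \<le> e r + \<bar>\<psi> x * g x\<bar>" using e_le[of x] x by linarith
  also have "\<bar>\<psi> x * g x\<bar> \<le> g r * \<bar>\<psi> x\<bar>"
    using g_le[of x] g_pos[of x] x by (simp add: abs_mult mult.commute mult_right_mono)
  finally show ?thesis using gamma_pos by (simp add: field_simps)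
qed

lemma nn_integral_psi_finite_iff:
  "(\<integral>\<^sup>+x\<in>{0..<r}. ennreal \<bar>\<psi> x\<bar> \<partial>lborel) < \<infinity> \<longleftrightarrow>
   (\<integral>\<^sup>+x\<in>{0..<r}. ennreal (w x) \<partial>lborel) < \<infinity>"
proof -
  \<comment> \<open>Domination by an affine function of \<open>k\<close> preserves a finite integral
    since [0,r) has finite measure; it serves both directions.\<close>
  have finite_mono: "(\<integral>\<^sup>+x\<in>{0..<r}. ennreal (h x) \<partial>lborel) < \<infinity>"
    if le: "\<And>x. 0 \<le> x \<Longrightarrow> x < r \<Longrightarrow> h x \<le> A + B * k x"
      and AB: "0 \<le> A" "0 \<le> B" and k: "\<And>x. 0 \<le> x \<Longrightarrow> x < r \<Longrightarrow> 0 \<le> k x" "continuous_on {0..<r} k"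
      and fin: "(\<integral>\<^sup>+x\<in>{0..<r}. ennreal (k x) \<partial>lborel) < \<infinity>"
    for h k :: "real \<Rightarrow> real" and A B
  proof -
    have meas: "(\<lambda>x. ennreal (k x) * indicator {0..<r} x) \<in> borel_measurable lborel"
    proof -
      have "(\<lambda>x. indicator {0..<r} x *\<^sub>R k x) \<in> borel_measurable borel"
        by (rule borel_measurable_continuous_on_indicator) (use k in auto)
      then have "(\<lambda>x. ennreal (indicator {0..<r} x *\<^sub>R k x)) \<in> borel_measurable lborel"
        by simp
      moreover have "ennreal (indicator {0..<r} x *\<^sub>R k x) = ennreal (k x) * indicator {0..<r} x" for x
        by (simp add: indicator_def)
      ultimately show ?thesis
        by simp
    qed
    have "(\<integral>\<^sup>+x\<in>{0..<r}. ennreal (h x) \<partial>lborel) \<le>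
        (\<integral>\<^sup>+x. ennreal A * indicator {0..<r} x + ennreal B * (ennreal (k x) * indicator {0..<r} x) \<partial>lborel)"
    proof (rule nn_integral_mono)
      fix x
      show "ennreal (h x) * indicator {0..<r} x \<le>
          ennreal A * indicator {0..<r} x + ennreal B * (ennreal (k x) * indicator {0..<r} x)"
      proof (cases "x \<in> {0..<r}")
        case True
        then have "ennreal (h x) \<le> ennreal (A + B * k x)" using le by (intro ennreal_leI) auto
        also have "\<dots> = ennreal A + ennreal B * ennreal (k x)"
          using True AB k(1) by (simp add: ennreal_mult)
        finally show ?thesis using True by simp
      qed simp
    qed
    also have "\<dots> = ennreal A * ennreal r + ennreal B * (\<integral>\<^sup>+x\<in>{0..<r}. ennreal (k x) \<partial>lborel)"
      using meas r_pos by (simp add: nn_integral_add nn_integral_cmult)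
    also have "\<dots> < \<infinity>"
      using fin by (simp add: ennreal_mult_less_top ennreal_mult_eq_top_iff less_top)
    finally show ?thesis .
  qed
  show ?thesis
  proof
    assume "(\<integral>\<^sup>+x\<in>{0..<r}. ennreal \<bar>\<psi> x\<bar> \<partial>lborel) < \<infinity>"
    then show "(\<integral>\<^sup>+x\<in>{0..<r}. ennreal (w x) \<partial>lborel) < \<infinity>"
      using w_le_abs_psi gamma_pos g_pos[of r] e_nonneg[of r] r_pos
      by (intro finite_mono[where h = w and k = "\<lambda>x. \<bar>\<psi> x\<bar>" and A = "e r / \<gamma>" and B = "g r / \<gamma>"])
        (auto intro!: continuous_intros continuous_on_psi)
  next
    assume "(\<integral>\<^sup>+x\<in>{0..<r}. ennreal (w x) \<partial>lborel) < \<infinity>"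
    then show "(\<integral>\<^sup>+x\<in>{0..<r}. ennreal \<bar>\<psi> x\<bar> \<partial>lborel) < \<infinity>"
      using abs_psi_le gamma_pos b_0_pos e_nonneg[of r] r_pos w_nonneg continuous_on_w
      by (intro finite_mono[where h = "\<lambda>x. \<bar>\<psi> x\<bar>" and k = w and A = "e r / b 0" and B = "\<gamma> / b 0"])
        auto
  qed
qed

section \<open>Slow variation of L\<close>

text \<open>The gauge integral suits the fundamental theorem of calculus. \<open>L_eq\<close>
  identifies it with the Lebesgue integral in \<open>L_qr\<close> on intervals that stay away from
  r.\<close>

definition Psi where "Psi t = integral {0..t} \<psi>"

lemma L_eq:
  assumes "0 < x"
  shows "L_qr p q r x = exp (Psi (r - x))"
proof -
  have "continuous_on {0..r - x} \<psi>"
    using assms by (intro continuous_on_subset[OF continuous_on_psi]) auto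
  then have "set_integrable lborel {0..r - x} \<psi>" by (rule borel_integrable_atLeastAtMost')
  then show ?thesis
    unfolding L_qr_def Psi_def by (simp add: set_borel_integral_eq_integral(2))
qed

lemma Psi_has_derivative:
  assumes "0 < t" "t < r"
  shows "(Psi has_real_derivative \<psi> t) (at t)"
proof -
  define s where "s = (t + r) / 2"
  have s: "t < s" "s < r" using assms by (auto simp: s_def)
  have "continuous_on {0..s} \<psi>"
    using s by (intro continuous_on_subset[OF continuous_on_psi]) auto
  then have "(Psi has_real_derivative \<psi> t) (at t within {0..s})"
    unfolding Psi_def using assms s by (intro integral_has_real_derivative) auto
  moreover have "t \<in> interior {0..s}" using assms s by simp
  ultimately show ?thesis by (metis at_within_interior)
qed

lemma mult_psi_tendsto_0: "((\<lambda>x. (r - x) * \<psi> x) \<longlongrightarrow> 0) (at_left r)"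
proof -
  have ev: "\<forall>\<^sub>F x in at_left r. x \<in> {0<..<r}" using r_pos by (rule eventually_at_leftI[rotated]) auto
  have g: "(g \<longlongrightarrow> g r) (at_left r)"
    using continuous_on_g r_pos
    by (auto simp: continuous_on_def at_within_Icc_at_left dest: bspec[where x = r])
  have e: "(e \<longlongrightarrow> e r) (at_left r)"
    using continuous_on_e r_pos
    by (auto simp: continuous_on_def at_within_Icc_at_left dest: bspec[where x = r])
  \<comment> \<open>Multiplication by r - x turns w into g r - g x, so nothing singular remains and
    continuity gives the limit.\<close>
  have "((\<lambda>x. ((r - x) * e x - \<gamma> * (g r - g x)) / g x) \<longlongrightarrow>
      ((r - r) * e r - \<gamma> * (g r - g r)) / g r) (at_left r)"
    using g_pos[of r] r_pos by (intro tendsto_intros g e) auto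
  then have "((\<lambda>x. ((r - x) * e x - \<gamma> * (g r - g x)) / g x) \<longlongrightarrow> 0) (at_left r)" by simp
  moreover have "\<forall>\<^sub>F x in at_left r. ((r - x) * e x - \<gamma> * (g r - g x)) / g x = (r - x) * \<psi> x"
    using ev
  proof eventually_elim
    case (elim x)
    then have "(r - x) * w x = g r - g x" by (simp add: w_def)
    then have "\<gamma> * (g r - g x) = (r - x) * (\<gamma> * w x)" by simp
    then show ?case using elim by (simp add: psi_eq right_diff_distrib)
  qed
  ultimately show ?thesis by (rule Lim_transform_eventually)
qed

text \<open>Mean value estimate: between the two points |psi| is at most \<eta> / (m * x), while
  their distance is |1 - l| * x, so x cancels.\<close>

lemma Psi_diff_tendsto_0:
  assumes l: "0 < l"
  shows "((\<lambda>x. Psi (r - l * x) - Psi (r - x)) \<longlongrightarrow> 0) (at_right 0)"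
proof (rule tendstoI)
  fix \<epsilon> :: real assume \<epsilon>: "0 < \<epsilon>"
  \<comment> \<open>The interval from r - M * x to r - m * x contains both points whether l is below
    or above 1.\<close>
  define m M where "m = min 1 l" and "M = max 1 l"
  have m: "0 < m" "m \<le> 1" "m \<le> l" and M: "1 \<le> M" "l \<le> M" using l by (auto simp: m_def M_def)
  \<comment> \<open>Chosen to make the final bound \<epsilon> * |1 - l| / (|1 - l| + 1), which is
    below \<epsilon>; the added 1 also covers l = 1.\<close>
  define \<eta> where "\<eta> = \<epsilon> * m / (\<bar>1 - l\<bar> + 1)"
  have \<eta>: "0 < \<eta>" using \<epsilon> m by (simp add: \<eta>_def)
  obtain s where s: "s < r" and small: "\<And>y. s < y \<Longrightarrow> y < r \<Longrightarrow> \<bar>(r - y) * \<psi> y\<bar> < \<eta>"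
    using tendstoD[OF mult_psi_tendsto_0 \<eta>] unfolding eventually_at_left_field by auto
  \<comment> \<open>This keeps the interval both inside the region where \<open>small\<close>
    applies and to the right of 0.\<close>
  define \<delta> where "\<delta> = min (r - s) r / M"
  have \<delta>: "0 < \<delta>" using s r_pos M by (simp add: \<delta>_def)
  have "dist (Psi (r - l * x) - Psi (r - x)) 0 < \<epsilon>" if x: "0 < x" "x < \<delta>" for x
  proof -
    have Mx: "M * x < r - s" "M * x < r" using x M by (auto simp: \<delta>_def field_simps)
    have mem: "r - l * x \<in> {r - M * x..r - m * x}" "r - x \<in> {r - M * x..r - m * x}"
      using x m M by (auto intro: mult_right_mono)
    have mx: "0 < m * x" using m x by simp
    have "norm (Psi (r - l * x) - Psi (r - x)) \<le> \<eta> / (m * x) * norm ((r - l * x) - (r - x))"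
    proof (rule field_differentiable_bound[OF _ _ _ mem])
      fix y assume y: "y \<in> {r - M * x..r - m * x}"
      then have y': "0 < y" "y < r" "s < y" "m * x \<le> r - y" using Mx mx by auto
      show "(Psi has_field_derivative \<psi> y) (at y within {r - M * x..r - m * x})"
        using Psi_has_derivative[OF y'(1,2)] by (rule has_field_derivative_at_within)
      have "\<bar>\<psi> y\<bar> * (m * x) \<le> \<bar>\<psi> y\<bar> * (r - y)" using y' by (intro mult_left_mono) auto
      also have "\<dots> \<le> \<eta>" using small[of y] y' by (simp add: abs_mult mult.commute)
      finally show "norm (\<psi> y) \<le> \<eta> / (m * x)" using mx by (simp add: pos_le_divide_eq)
    qed simp
    also have "norm ((r - l * x) - (r - x)) = \<bar>1 - l\<bar> * x"
      using x abs_mult[of "1 - l" x] by (simp add: left_diff_distrib)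
    also have "\<eta> / (m * x) * (\<bar>1 - l\<bar> * x) = \<epsilon> * (\<bar>1 - l\<bar> / (\<bar>1 - l\<bar> + 1))"
      using m x by (simp add: \<eta>_def)
    also have "\<dots> < \<epsilon>" using \<epsilon> by (simp add: field_simps)
    finally show ?thesis by simp
  qed
  then show "\<forall>\<^sub>F x in at_right 0. dist (Psi (r - l * x) - Psi (r - x)) 0 < \<epsilon>"
    using \<delta> by (auto simp: eventually_at_right_field)
qed

lemma slowly_varying_L: "slowly_varying_at_0 (L_qr p q r)"
  unfolding slowly_varying_at_0_def
proof (intro conjI allI impI)
  show "\<forall>\<^sub>F x in at_right 0. 0 < L_qr p q r x" by (simp add: L_qr_def)
  fix l :: real assume l: "0 < l"
  have "((\<lambda>x. exp (Psi (r - l * x) - Psi (r - x))) \<longlongrightarrow> exp 0) (at_right 0)"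
    by (intro tendsto_exp Psi_diff_tendsto_0 l)
  moreover have "\<forall>\<^sub>F x in at_right 0. exp (Psi (r - l * x) - Psi (r - x)) = L_qr p q r (l * x) / L_qr p q r x"
    using l by (auto simp: eventually_at_right_field L_eq exp_diff intro!: exI[of _ 1])
  ultimately show "((\<lambda>x. L_qr p q r (l * x) / L_qr p q r x) \<longlongrightarrow> 1) (at_right 0)"
    using Lim_transform_eventually by fastforce
qed

section \<open>Convergence of L to 0\<close>

text \<open>On [0,r), w dominates each partial sum of its series. Replacing w by such a polynomial
  gives an upper bound for psi with an explicit antiderivative.\<close>

lemma Psi_le:
  assumes t: "0 \<le> t" "t < r"
  shows "Psi t \<le> e r / b 0 * t - \<gamma> / g r * (\<Sum>j<N. W j * (t ^ Suc j / real (Suc j)))"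
proof -
  define F where "F t = e r / b 0 * t - \<gamma> / g r * (\<Sum>j<N. W j * (t ^ Suc j / real (Suc j)))" for t
  define f where "f t = e r / b 0 - \<gamma> / g r * (\<Sum>j<N. W j * t ^ j)" for t
  have "(F has_real_derivative f x) (at x within {0..t})" for x
    unfolding F_def f_def using b_0_pos g_pos[of r] r_pos
    by (auto intro!: derivative_eq_intros sum.cong simp del: power_Suc)
  then have "(f has_integral (F t - F 0)) {0..t}"
    using t by (intro fundamental_theorem_of_calculus)
      (auto simp: has_real_derivative_iff_has_vector_derivative)
  then have f: "f integrable_on {0..t}" "integral {0..t} f = F t"
    by (auto simp: F_def integral_unique has_integral_integrable)
  have "Psi t \<le> integral {0..t} f"
    unfolding Psi_def
  proof (rule integral_le[OF _ f(1)])
    show "\<psi> integrable_on {0..t}"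
      using t by (intro integrable_continuous_real continuous_on_subset[OF continuous_on_psi]) auto
    fix x assume "x \<in> {0..t}"
    then have x: "0 \<le> x" "x < r" using t by auto
    have "(\<Sum>j<N. W j * x ^ j) \<le> w x"
      using sum_le_suminf[OF sums_summable[OF sums_W[OF x]], of "{..<N}"] sums_W[OF x] W_nonneg x
      by (simp add: sums_iff)
    then have "\<gamma> / g r * (\<Sum>j<N. W j * x ^ j) \<le> \<gamma> / g r * w x"
      using gamma_pos g_pos[of r] r_pos by (intro mult_left_mono) auto
    also have "\<dots> \<le> \<gamma> * w x / g x"
      using gamma_pos g_pos[of x] g_le[of x] w_nonneg[OF x] x by (simp add: frac_le)
    finally have "\<gamma> / g r * (\<Sum>j<N. W j * x ^ j) \<le> \<gamma> * w x / g x" .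
    moreover have "e x / g x \<le> e r / b 0"
      using x e_le[of x] e_nonneg[of r] g_ge[of x] b_0_pos r_pos by (intro frac_le) auto
    ultimately show "\<psi> x \<le> f x" using x by (simp add: psi_eq f_def diff_divide_distrib)
  qed
  then show ?thesis by (simp add: f(2) F_def)
qed

lemma Psi_at_bot:
  assumes "\<not> (\<lambda>k. p k * r ^ k * real k * ln (real k)) summable_on {2..}"
  shows "filterlim Psi at_bot (at_left r)"
  unfolding filterlim_at_bot
proof
  fix Z
  define Q where "Q N t = (\<Sum>j<N. W j * (t ^ Suc j / real (Suc j)))" for N t
  \<comment> \<open>\<open>K\<close> solves e r / b 0 * r - gamma / g r * K = Z, so a partial sum
    above \<open>K\<close> pushes the bound of \<open>Psi_le\<close> down to Z.\<close>
  define K where "K = (e r / b 0 * r - Z) * g r / \<gamma>"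
  have "\<exists>N. K < Q N r"
  proof (rule ccontr)
    assume "\<not> ?thesis"
    then have "summable (\<lambda>j. W j * (r ^ Suc j / real (Suc j)))"
      unfolding Q_def using W_nonneg r_pos
      by (intro summableI_nonneg_bounded[where x = K]) (auto simp: not_less simp del: power_Suc)
    then show False using assms unfolding summable_W_iff_summable_u summable_u_iff by simp
  qed
  then obtain N where N: "K < Q N r" ..
  \<comment> \<open>Divergence is used only at r, to fix \<open>N\<close>; the polynomial
    \<open>Q N\<close> is continuous, so it still exceeds \<open>K\<close> slightly to the left of
    r.\<close>
  have "(Q N \<longlongrightarrow> Q N r) (at_left r)"
    unfolding Q_def by (intro tendsto_intros) auto
  then have "\<forall>\<^sub>F t in at_left r. K < Q N t" using N by (rule order_tendstoD)
  moreover have "\<forall>\<^sub>F t in at_left r. t \<in> {0<..<r}"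
    using r_pos by (rule eventually_at_leftI[rotated]) auto
  ultimately show "\<forall>\<^sub>F t in at_left r. Psi t \<le> Z"
  proof eventually_elim
    case (elim t)
    have "Psi t \<le> e r / b 0 * t - \<gamma> / g r * Q N t" using Psi_le[of t N] elim by (simp add: Q_def)
    also have "\<dots> \<le> e r / b 0 * r - \<gamma> / g r * K"
      using elim gamma_pos g_pos[of r] r_pos e_nonneg[of r] b_0_pos
      by (intro diff_mono mult_left_mono) auto
    also have "\<dots> = Z" using gamma_pos g_pos[of r] r_pos by (simp add: K_def)
    finally show ?case .
  qed
qed

lemma L_tendsto_0:
  assumes "\<not> (\<lambda>k. p k * r ^ k * real k * ln (real k)) summable_on {2..}"
  shows "(L_qr p q r \<longlongrightarrow> 0) (at_right 0)"
proof -
  have "filterlim (\<lambda>x. r - x) (at_left r) (at_right 0)"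
    unfolding filterlim_at
    by (auto intro!: tendsto_eq_intros simp: eventually_at_right_field intro: exI[of _ 1])
  then have "((\<lambda>x. exp (Psi (r - x))) \<longlongrightarrow> 0) (at_right 0)"
    by (intro filterlim_compose[OF exp_at_bot] filterlim_compose[OF Psi_at_bot[OF assms]])
  moreover have "\<forall>\<^sub>F x in at_right 0. exp (Psi (r - x)) = L_qr p q r x"
    by (auto simp: eventually_at_right_field L_eq intro!: exI[of _ 1])
  ultimately show ?thesis by (rule Lim_transform_eventually)
qed

end

theorem proposition14:
  fixes p :: "nat \<Rightarrow> real" and q r :: real
  assumes "defective_pgf p"
    and "extendable q r p"
    and "pgf_deriv_finite p r"
  shows
    "((\<integral>\<^sup>+ x\<in>{0..<r}. ennreal \<bar>psi_qr p q r x\<bar> \<partial>lborel) < \<infinity> \<longleftrightarrow>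
        (\<lambda>k. p k * r ^ k * real k * ln (real k)) summable_on {2..}) \<and>
     (\<not> (\<lambda>k. p k * r ^ k * real k * ln (real k)) summable_on {2..} \<longrightarrow>
        slowly_varying_at_0 (L_qr p q r) \<and>
        (L_qr p q r \<longlongrightarrow> 0) (at_right 0))"
proof -
  interpret extendable_pgf p q r by unfold_locales (fact assms)+
  show ?thesis
    using nn_integral_psi_finite_iff nn_integral_w_finite_iff slowly_varying_L L_tendsto_0 by simp
qed

end
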